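(* Let $\Bbbk$ be a commutative ring, let $X$ be a finite set, let $\leq$ be an admissible order on the free monoid $W(X)$ and let $\preccurlyeq$ be an admissible $\mathbb N$-order on $W(X)$. Assume that $R\subset I(\Bbbk\langle X\rangle)$ is a Gröbner–Shirshov basis in $\Bbbk\langle X\rangle$ with respect to $\leq$ and $S\subset I(\Bbbk\langle\!\langle X\rangle\!\rangle)$ is a Gröbner–Shirshov basis in $\Bbbk\langle\!\langle X\rangle\!\rangle$ with respect to $\preccurlyeq$ such that (i) $\overline{(\iota(R))}=\overline{(S)}$, and (ii) $\mathsf{MT}_{\leq}(R)=\mathsf{mt}_{\preccurlyeq}(S)$. Then the augmented algebra $\Bbbk\langle X\rangle/(R)$ is residually nilpotent.
   Context: $W=W(X)$ is the free monoid on $X$ (words). $\Bbbk\langle X\rangle$ is the free associative algebra and $\Bbbk\langle\!\langle X\rangle\!\rangle$ the algebra of non-commutative formal power series $\sum_{w\in W}\alpha_w w$; $\iota:\Bbbk\langle X\rangle\to\Bbbk\langle\!\langle X\rangle\!\rangle$ is the inclusion. Both are augmented over $\Bbbk$ by taking the constant coefficient; $I(\cdot)$ denotes the augmentation ideal (kernel of the augmentation), and $\Bbbk\langle\!\langle X\rangle\!\rangle$ carries the $I$-adic topology. An augmented algebra $A$ (an algebra with a homomorphism to $\Bbbk$, with kernel $I(A)$) is residually nilpotent if $\bigcap_{n\ge1}I(A)^n=0$. The quotient $\Bbbk\langle X\rangle/(R)$ has the induced augmentation. An order on $W$ is admissible if it is total, $1<m$ for all $m\ne1$, and $m_1<m_2$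 implies $m'm_1m''<m'm_2m''$ for all $m',m''$. An $\mathbb N$-order is a total order in which every subset bounded above is finite. $\mathrm{supp}(f)$ is the set of words with nonzero coefficient in $f$. For nonzero $p\in\Bbbk\langle X\rangle$, $\mathsf{MT}_{\leq}(p)$ is the $\leq$-maximal element of $\mathrm{supp}(p)$; for nonzero $f\in\Bbbk\langle\!\langle X\rangle\!\rangle$, $\mathsf{mt}_{\preccurlyeq}(f)$ is the $\preccurlyeq$-minimal element of $\mathrm{supp}(f)$. For a set $T$ of nonzero elements, $\mathsf{MT}_\leq(T)$ and $\mathsf{mt}_\preccurlyeq(T)$ are the sets of all such words of elements of $T$. A polynomial $p$ (resp. power series $f$) is monic if the coefficient of $\mathsf{MT}_\leq(p)$ (resp. $\mathsf{mt}_\preccurlyeq(f)$) is $1$. $(T)$ is the two-sided ideal generated by $T$; in $\Bbbk\langle\!\langle X\rangle\!\rangle$, $\overline{(T)}$ is its closure. $R\subset\Bbbk\langle X\rangle$ is a Gröbner–Shirshov basis with respect to $\leq$ if all its elements are monic and $W\,\mathsf{MT}_\leq(R)\,W=\mathsf{MT}_\leq((R)\setminus 0)$. $S\subset\Bbbk\langle\!\langle X\rangle\!\rangle$ is a Gröbner–Shirshov basis with respect to $\preccurlyeq$ if all its elements are monic and $W\,\mathsf{mt}_\preccurlyeq(S)\,W=\mathsf{mt}_\preccurlyeq(\overline{(S)}\setminus0)$. *)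

theory Defs
  imports "HOL-Algebra.Ideal_Product" "HOL-Algebra.QuotRing" "HOL-Analysis.Abstract_Topology"
begin

text \<open>The free monoid on a set \<open>X\<close> is \<open>lists X\<close> with concatenation and unit \<open>[]\<close>.
  Polynomials and power series in the non-commuting variables \<open>X\<close> over \<open>K\<close> are both modelled by
  their coefficient functions on words, set to \<open>\<zero>\<close> on words that are not in \<open>lists X\<close>; the
  inclusion of the free algebra into the algebra of formal power series is then the inclusion of
  carriers.\<close>

definition supp :: "('k, 'm) ring_scheme \<Rightarrow> ('x list \<Rightarrow> 'k) \<Rightarrow> 'x list set"
  where "supp K f = {w. f w \<noteq> \<zero>\<^bsub>K\<^esub>}"

definition power_series :: "('k, 'm) ring_scheme \<Rightarrow> 'x set \<Rightarrow> ('x list \<Rightarrow> 'k) ring"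
  where "power_series K X =
    \<lparr>carrier = {f. range f \<subseteq> carrier K \<and> supp K f \<subseteq> lists X},
     mult = (\<lambda>f g w. \<Oplus>\<^bsub>K\<^esub>i\<in>{..length w}. f (take i w) \<otimes>\<^bsub>K\<^esub> g (drop i w)),
     one = (\<lambda>w. if w = [] then \<one>\<^bsub>K\<^esub> else \<zero>\<^bsub>K\<^esub>),
     zero = (\<lambda>w. \<zero>\<^bsub>K\<^esub>),
     add = (\<lambda>f g w. f w \<oplus>\<^bsub>K\<^esub> g w)\<rparr>"

definition free_algebra :: "('k, 'm) ring_scheme \<Rightarrow> 'x set \<Rightarrow> ('x list \<Rightarrow> 'k) ring"
  where "free_algebra K X =
    (power_series K X)\<lparr>carrier := {f \<in> carrier (power_series K X). finite (supp K f)}\<rparr>"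

definition const_coeff :: "('x list \<Rightarrow> 'k) \<Rightarrow> 'k"
  where "const_coeff f = f []"

text \<open>An augmented algebra is represented by its underlying ring \<open>A\<close> and its augmentation
  \<open>\<epsilon>\<close> to \<open>K\<close>; powers of ideals are taken in the monoid of two-sided ideals under the product of
  ideals.\<close>

definition aug_ideal :: "('k, 'm) ring_scheme \<Rightarrow> ('a, 'n) ring_scheme \<Rightarrow> ('a \<Rightarrow> 'k) \<Rightarrow> 'a set"
  where "aug_ideal K A \<epsilon> = a_kernel A K \<epsilon>"

definition residually_nilpotent ::
    "('k, 'm) ring_scheme \<Rightarrow> ('a, 'n) ring_scheme \<Rightarrow> ('a \<Rightarrow> 'k) \<Rightarrow> bool"
  where "residually_nilpotent K A \<epsilon> \<longleftrightarrow>
    (\<Inter>n\<in>{1::nat..}. aug_ideal K A \<epsilon> [^]\<^bsub>ideals_set A\<^esub> n) = {\<zero>\<^bsub>A\<^esub>}"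

text \<open>The map induced by \<open>\<epsilon>\<close> on cosets; it is well-defined on \<open>A Quot J\<close> whenever the ideal
  \<open>J\<close> is contained in the kernel of \<open>\<epsilon>\<close>.\<close>

definition induced_aug :: "('a \<Rightarrow> 'k) \<Rightarrow> 'a set \<Rightarrow> 'k"
  where "induced_aug \<epsilon> C = the_elem (\<epsilon> ` C)"

definition adic_topology :: "('a, 'n) ring_scheme \<Rightarrow> 'a set \<Rightarrow> 'a topology"
  where "adic_topology A I =
    topology_generated_by {(I [^]\<^bsub>ideals_set A\<^esub> n) +>\<^bsub>A\<^esub> a | (n::nat) a. a \<in> carrier A}"

definition closed_ideal :: "('k, 'm) ring_scheme \<Rightarrow> 'x set \<Rightarrow> ('x list \<Rightarrow> 'k) set \<Rightarrow> ('x list \<Rightarrow> 'k) set"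
  where "closed_ideal K X T =
    adic_topology (power_series K X) (aug_ideal K (power_series K X) const_coeff)
      closure_of (Idl\<^bsub>power_series K X\<^esub> T)"

definition admissible :: "'x set \<Rightarrow> 'x list rel \<Rightarrow> bool"
  where "admissible X r \<longleftrightarrow>
    linear_order_on (lists X) r \<and>
    (\<forall>m\<in>lists X. m \<noteq> [] \<longrightarrow> ([], m) \<in> r - Id) \<and>
    (\<forall>m\<^sub>1\<in>lists X. \<forall>m\<^sub>2\<in>lists X. \<forall>u\<in>lists X. \<forall>v\<in>lists X.
       (m\<^sub>1, m\<^sub>2) \<in> r - Id \<longrightarrow> (u @ m\<^sub>1 @ v, u @ m\<^sub>2 @ v) \<in> r - Id)"

definition N_order_on :: "'a set \<Rightarrow> 'a rel \<Rightarrow> bool"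
  where "N_order_on A r \<longleftrightarrow>
    linear_order_on A r \<and>
    (\<forall>B\<subseteq>A. (\<exists>b\<in>A. \<forall>a\<in>B. (a, b) \<in> r) \<longrightarrow> finite B)"

text \<open>The largest and the smallest word of the support; meaningful for nonzero polynomials,
  respectively for nonzero power series when \<open>r\<close> is an \<open>\<nat>\<close>-order.\<close>

definition MT :: "('k, 'm) ring_scheme \<Rightarrow> 'x list rel \<Rightarrow> ('x list \<Rightarrow> 'k) \<Rightarrow> 'x list"
  where "MT K r p = (THE m. m \<in> supp K p \<and> (\<forall>w\<in>supp K p. (w, m) \<in> r))"

definition mt :: "('k, 'm) ring_scheme \<Rightarrow> 'x list rel \<Rightarrow> ('x list \<Rightarrow> 'k) \<Rightarrow> 'x list"
  where "mt K r f = (THE m. m \<in> supp K f \<and> (\<forall>w\<in>supp K f. (m, w) \<in> r))"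

definition MT_monic :: "('k, 'm) ring_scheme \<Rightarrow> 'x list rel \<Rightarrow> ('x list \<Rightarrow> 'k) \<Rightarrow> bool"
  where "MT_monic K r p \<longleftrightarrow> supp K p \<noteq> {} \<and> p (MT K r p) = \<one>\<^bsub>K\<^esub>"

definition mt_monic :: "('k, 'm) ring_scheme \<Rightarrow> 'x list rel \<Rightarrow> ('x list \<Rightarrow> 'k) \<Rightarrow> bool"
  where "mt_monic K r f \<longleftrightarrow> supp K f \<noteq> {} \<and> f (mt K r f) = \<one>\<^bsub>K\<^esub>"

definition multiples :: "'x set \<Rightarrow> 'x list set \<Rightarrow> 'x list set"
  where "multiples X M = {u @ m @ v | u m v. u \<in> lists X \<and> m \<in> M \<and> v \<in> lists X}"

definition GS_basis_poly ::
    "('k, 'm) ring_scheme \<Rightarrow> 'x set \<Rightarrow> 'x list rel \<Rightarrow> ('x list \<Rightarrow> 'k) set \<Rightarrow> bool"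
  where "GS_basis_poly K X r R \<longleftrightarrow>
    R \<subseteq> carrier (free_algebra K X) \<and>
    (\<forall>p\<in>R. MT_monic K r p) \<and>
    multiples X (MT K r ` R) =
      MT K r ` ((Idl\<^bsub>free_algebra K X\<^esub> R) - {\<zero>\<^bsub>free_algebra K X\<^esub>})"

definition GS_basis_series ::
    "('k, 'm) ring_scheme \<Rightarrow> 'x set \<Rightarrow> 'x list rel \<Rightarrow> ('x list \<Rightarrow> 'k) set \<Rightarrow> bool"
  where "GS_basis_series K X r S \<longleftrightarrow>
    S \<subseteq> carrier (power_series K X) \<and>
    (\<forall>f\<in>S. mt_monic K r f) \<and>
    multiples X (mt K r ` S) =
      mt K r ` (closed_ideal K X S - {\<zero>\<^bsub>power_series K X\<^esub>})"

end

theory Submission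
  imports Defs "HOL-Algebra.Subrings" "HOL-Library.Sublist"
begin

text \<open>An admissible order on the words over a finite alphabet is a well-order, so modulo the ideal
  \<open>(R)\<close> every polynomial reduces to one supported on words that are not multiples of a word in
  \<open>MT(R)\<close>. An element of \<open>K\<langle>X\<rangle>/(R)\<close> lying in all powers of the augmentation ideal
  is represented by such a normal form \<open>b\<close>, and \<open>b\<close> lies in the \<open>I\<close>-adic closure of
  \<open>(R)\<close> in the power series algebra, which is the closure of \<open>(S)\<close>. If \<open>b\<close> were
  nonzero, its smallest word would be a multiple of a word in \<open>mt(S) = MT(R)\<close>; hence
  \<open>b = 0\<close>.\<close>

section \<open>Power series and polynomials as rings\<close>

text \<open>The multiplication of \<open>power_series\<close>, named apart from the record: it does
  not mention \<open>X\<close>, so the same facts serve both rings and hold for arbitrary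
  coefficient functions.\<close>

definition cauchy_prod ::
    "('k, 'm) ring_scheme \<Rightarrow> ('x list \<Rightarrow> 'k) \<Rightarrow> ('x list \<Rightarrow> 'k) \<Rightarrow> 'x list \<Rightarrow> 'k"
  where "cauchy_prod K f g w = (\<Oplus>\<^bsub>K\<^esub>i\<in>{..length w}. f (take i w) \<otimes>\<^bsub>K\<^esub> g (drop i w))"

definition monomial :: "('k, 'm) ring_scheme \<Rightarrow> 'k \<Rightarrow> 'x list \<Rightarrow> 'x list \<Rightarrow> 'k"
  where "monomial K c u = (\<lambda>w. if w = u then c else \<zero>\<^bsub>K\<^esub>)"

lemma power_series_simps [simp]:
  "mult (power_series K X) = cauchy_prod K"
  "one (power_series K X) = monomial K \<one>\<^bsub>K\<^esub> []"
  "zero (power_series K X) = (\<lambda>w. \<zero>\<^bsub>K\<^esub>)"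
  "add (power_series K X) = (\<lambda>f g w. f w \<oplus>\<^bsub>K\<^esub> g w)"
  by (simp_all add: power_series_def cauchy_prod_def monomial_def fun_eq_iff)

lemma free_algebra_simps [simp]:
  "mult (free_algebra K X) = cauchy_prod K"
  "one (free_algebra K X) = monomial K \<one>\<^bsub>K\<^esub> []"
  "zero (free_algebra K X) = (\<lambda>w. \<zero>\<^bsub>K\<^esub>)"
  "add (free_algebra K X) = (\<lambda>f g w. f w \<oplus>\<^bsub>K\<^esub> g w)"
  by (simp_all add: free_algebra_def)

lemma power_series_carrier:
  "f \<in> carrier (power_series K X) \<longleftrightarrow> (\<forall>w. f w \<in> carrier K) \<and> supp K f \<subseteq> lists X"
  by (auto simp: power_series_def)

lemma free_algebra_carrier:
  "f \<in> carrier (free_algebra K X) \<longleftrightarrow> f \<in> carrier (power_series K X) \<and> finite (supp K f)"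
  by (auto simp: free_algebra_def)

context ring
begin

lemma cauchy_prod_closed [simp]:
  "\<lbrakk>\<And>w. f w \<in> carrier R; \<And>w. g w \<in> carrier R\<rbrakk> \<Longrightarrow> cauchy_prod R f g w \<in> carrier R"
  by (simp add: cauchy_prod_def)

lemma cauchy_prod_Nil:
  "\<lbrakk>\<And>w. f w \<in> carrier R; \<And>w. g w \<in> carrier R\<rbrakk> \<Longrightarrow> cauchy_prod R f g [] = f [] \<otimes> g []"
  by (simp add: cauchy_prod_def)

text \<open>The empty prefix is split off; all other prefixes of \<open>a # w\<close> start with
  \<open>a\<close>. The shift \<open>\<lambda>v. f (a # v)\<close> is the left derivative of
  \<open>f\<close> by \<open>a\<close>. This recursion on words makes associativity an induction,
  with no reindexing of double sums.\<close>

lemma cauchy_prod_Cons: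
  "\<lbrakk>\<And>w. f w \<in> carrier R; \<And>w. g w \<in> carrier R\<rbrakk> \<Longrightarrow>
    cauchy_prod R f g (a # w) = f [] \<otimes> g (a # w) \<oplus> cauchy_prod R (\<lambda>v. f (a # v)) g w"
  unfolding cauchy_prod_def length_Cons by (subst finsum_Suc2) (auto intro: a_comm)

lemma cauchy_prod_add_left:
  assumes "\<And>w. f w \<in> carrier R" "\<And>w. g w \<in> carrier R" "\<And>w. h w \<in> carrier R"
  shows "cauchy_prod R (\<lambda>w. f w \<oplus> g w) h w = cauchy_prod R f h w \<oplus> cauchy_prod R g h w"
  using assms by (simp add: cauchy_prod_def l_distr flip: finsum_addf)

lemma cauchy_prod_add_right:
  assumes "\<And>w. f w \<in> carrier R" "\<And>w. g w \<in> carrier R" "\<And>w. h w \<in> carrier R"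
  shows "cauchy_prod R h (\<lambda>w. f w \<oplus> g w) w = cauchy_prod R h f w \<oplus> cauchy_prod R h g w"
  using assms by (simp add: cauchy_prod_def r_distr flip: finsum_addf)

lemma cauchy_prod_scale:
  assumes "\<And>w. f w \<in> carrier R" "\<And>w. g w \<in> carrier R" "c \<in> carrier R"
  shows "cauchy_prod R (\<lambda>w. c \<otimes> f w) g w = c \<otimes> cauchy_prod R f g w"
proof -
  have "cauchy_prod R (\<lambda>w. c \<otimes> f w) g w
      = (\<Oplus>i\<in>{..length w}. c \<otimes> (f (take i w) \<otimes> g (drop i w)))"
    using assms by (simp add: cauchy_prod_def m_assoc)
  also have "\<dots> = c \<otimes> cauchy_prod R f g w"
    using assms by (simp add: cauchy_prod_def finsum_rdistr)
  finally show ?thesis .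
qed

lemma cauchy_prod_assoc:
  assumes "\<And>w. f w \<in> carrier R" "\<And>w. g w \<in> carrier R" "\<And>w. h w \<in> carrier R"
  shows "cauchy_prod R (cauchy_prod R f g) h w = cauchy_prod R f (cauchy_prod R g h) w"
  using assms
proof (induction w arbitrary: f g h)
  case Nil
  then show ?case by (simp add: cauchy_prod_Nil m_assoc)
next
  case (Cons a w)
  note [simp] = Cons.prems
  \<comment> \<open>The derivative of the inner product is \<open>f []\<close> times the derivative
    of \<open>g\<close> plus the derivative of \<open>f\<close> times \<open>g\<close>. The last
    summand matches the induction hypothesis with \<open>f\<close> replaced by its
    derivative.\<close>
  have "cauchy_prod R (cauchy_prod R f g) h (a # w)
      = f [] \<otimes> (g [] \<otimes> h (a # w))
        \<oplus> (f [] \<otimes> cauchy_prod R (\<lambda>v. g (a # v)) h w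
            \<oplus> cauchy_prod R (cauchy_prod R (\<lambda>v. f (a # v)) g) h w)"
    by (simp add: cauchy_prod_Cons cauchy_prod_Nil cauchy_prod_add_left cauchy_prod_scale m_assoc)
  also have "\<dots> = cauchy_prod R f (cauchy_prod R g h) (a # w)"
    by (simp add: cauchy_prod_Cons Cons.IH r_distr a_assoc)
  finally show ?case .
qed

section \<open>Multiplication by monomials\<close>

lemma monomial_closed [simp]: "c \<in> carrier R \<Longrightarrow> monomial R c u w \<in> carrier R"
  by (simp add: monomial_def)

lemma cauchy_prod_monomial_left:
  assumes "\<And>w. f w \<in> carrier R" "c \<in> carrier R"
  shows "cauchy_prod R (monomial R c u) f (u @ w) = c \<otimes> f w"
proof -
  have "monomial R c u (take i (u @ w)) \<otimes> f (drop i (u @ w))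
      = (if length u = i then c \<otimes> f (drop i (u @ w)) else \<zero>)" if "i \<le> length (u @ w)" for i
  proof -
    \<comment> \<open>The bound on \<open>i\<close> matters: for \<open>w = []\<close> every larger
      \<open>i\<close> would also return \<open>u\<close>.\<close>
    have "take i (u @ w) = u \<longleftrightarrow> length u = i"
      using that by (metis append_eq_conv_conj length_take min.absorb2)
    then show ?thesis using assms by (auto simp: monomial_def)
  qed
  then have "cauchy_prod R (monomial R c u) f (u @ w)
      = (\<Oplus>i\<in>{..length (u @ w)}. if length u = i then c \<otimes> f (drop i (u @ w)) else \<zero>)"
    unfolding cauchy_prod_def using assms by (intro finsum_cong') auto
  also have "\<dots> = c \<otimes> f w"
    using assms by (subst finsum_singleton) auto
  finally show ?thesis .
qed

lemma cauchy_prod_monomial_right: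
  assumes "\<And>w. f w \<in> carrier R" "c \<in> carrier R"
  shows "cauchy_prod R f (monomial R c v) (w @ v) = f w \<otimes> c"
proof -
  have "f (take i (w @ v)) \<otimes> monomial R c v (drop i (w @ v))
      = (if length w = i then f (take i (w @ v)) \<otimes> c else \<zero>)" if "i \<le> length (w @ v)" for i
  proof -
    have "drop i (w @ v) = v \<longleftrightarrow> length w = i"
    proof
      assume "drop i (w @ v) = v"
      then have "length (drop i (w @ v)) = length v" by (rule arg_cong)
      with that show "length w = i" by auto
    qed auto
    then show ?thesis using assms by (auto simp: monomial_def)
  qed
  then have "cauchy_prod R f (monomial R c v) (w @ v)
      = (\<Oplus>i\<in>{..length (w @ v)}. if length w = i then f (take i (w @ v)) \<otimes> c else \<zero>)"
    unfolding cauchy_prod_def using assms by (intro finsum_cong') auto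
  also have "\<dots> = f w \<otimes> c"
    using assms by (subst finsum_singleton) auto
  finally show ?thesis .
qed

section \<open>Supports of products, sums and inverses\<close>

lemma supp_cauchy_prodE:
  assumes "\<And>w. f w \<in> carrier R" "\<And>w. g w \<in> carrier R" "w \<in> supp R (cauchy_prod R f g)"
  obtains u v where "w = u @ v" "u \<in> supp R f" "v \<in> supp R g"
proof -
  have "\<exists>i. f (take i w) \<otimes> g (drop i w) \<noteq> \<zero>"
  proof (rule ccontr)
    assume "\<not> ?thesis"
    then have "cauchy_prod R f g w = \<zero>"
      by (simp add: cauchy_prod_def)
    with assms(3) show False by (simp add: supp_def)
  qed
  then obtain i where "f (take i w) \<otimes> g (drop i w) \<noteq> \<zero>" ..
  then have "take i w \<in> supp R f" "drop i w \<in> supp R g"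
    using assms by (auto simp: supp_def)
  then show thesis
    using that[of "take i w" "drop i w"] by simp
qed

text \<open>The bound is the image of a Cartesian product, so finiteness passes from the two
  supports to that of the product.\<close>

lemma supp_cauchy_prod:
  assumes "\<And>w. f w \<in> carrier R" "\<And>w. g w \<in> carrier R"
  shows "supp R (cauchy_prod R f g) \<subseteq> (\<lambda>(u, v). u @ v) ` (supp R f \<times> supp R g)"
proof
  fix w assume "w \<in> supp R (cauchy_prod R f g)"
  with assms obtain u v where "w = u @ v" "u \<in> supp R f" "v \<in> supp R g"
    by (rule supp_cauchy_prodE)
  then show "w \<in> (\<lambda>(u, v). u @ v) ` (supp R f \<times> supp R g)"
    by (intro image_eqI[of _ _ "(u, v)"]) auto
qed

lemma supp_add:
  assumes "\<And>w. f w \<in> carrier R" "\<And>w. g w \<in> carrier R"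
  shows "supp R (\<lambda>w. f w \<oplus> g w) \<subseteq> supp R f \<union> supp R g"
  using assms by (auto simp: supp_def)

lemma supp_uminus:
  assumes "\<And>w. f w \<in> carrier R"
  shows "supp R (\<lambda>w. \<ominus> f w) = supp R f"
  using assms by (auto simp: supp_def)

lemma supp_monomial: "supp R (monomial R c u) \<subseteq> {u}"
  by (auto simp: supp_def monomial_def)

lemma monomial_in_free_algebra:
  "c \<in> carrier R \<Longrightarrow> u \<in> lists X \<Longrightarrow> monomial R c u \<in> carrier (free_algebra R X)"
  using supp_monomial[of c u] finite_subset[OF supp_monomial]
  by (auto simp: free_algebra_carrier power_series_carrier)

section \<open>Ring structures and augmentations\<close>

lemma power_series_mult_closed:
  assumes "f \<in> carrier (power_series R X)" "g \<in> carrier (power_series R X)"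
  shows "cauchy_prod R f g \<in> carrier (power_series R X)"
proof -
  have fg: "\<And>w. f w \<in> carrier R" "\<And>w. g w \<in> carrier R"
    and s: "supp R f \<subseteq> lists X" "supp R g \<subseteq> lists X"
    using assms by (simp_all add: power_series_carrier)
  have "(\<lambda>(u, v). u @ v) ` (supp R f \<times> supp R g) \<subseteq> lists X"
    using s by force
  with supp_cauchy_prod[of f g] fg show ?thesis
    by (simp add: power_series_carrier subset_trans)
qed

lemma power_series_add_closed:
  "\<lbrakk>f \<in> carrier (power_series R X); g \<in> carrier (power_series R X)\<rbrakk> \<Longrightarrow>
    (\<lambda>w. f w \<oplus> g w) \<in> carrier (power_series R X)"
  using supp_add[of f g] by (fastforce simp: power_series_carrier)

lemma power_series_uminus_closed:
  "f \<in> carrier (power_series R X) \<Longrightarrow> (\<lambda>w. \<ominus> f w) \<in> carrier (power_series R X)"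
  using supp_uminus[of f] by (auto simp: power_series_carrier)

lemma ring_power_series: "ring (power_series R X)"
proof (rule ringI)
  let ?P = "power_series R X"
  have cl: "f w \<in> carrier R" if "f \<in> carrier ?P" for f w
    using that by (simp add: power_series_carrier)
  show "abelian_group ?P"
  proof (rule abelian_groupI)
    show "\<exists>y\<in>carrier ?P. y \<oplus>\<^bsub>?P\<^esub> x = \<zero>\<^bsub>?P\<^esub>" if "x \<in> carrier ?P" for x
      using that power_series_uminus_closed[OF that]
      by (intro bexI[of _ "\<lambda>w. \<ominus> x w"]) (auto simp: cl l_neg)
    show "\<zero>\<^bsub>?P\<^esub> \<in> carrier ?P"
      by (simp add: power_series_carrier supp_def)
  qed (auto simp: fun_eq_iff cl a_ac intro!: power_series_add_closed)
  show "monoid ?P"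
  proof (rule monoidI)
    show "\<one>\<^bsub>?P\<^esub> \<in> carrier ?P"
      using monomial_in_free_algebra[of \<one> "[]" X] by (simp add: free_algebra_carrier)
  next
    fix x assume x: "x \<in> carrier ?P"
    show "\<one>\<^bsub>?P\<^esub> \<otimes>\<^bsub>?P\<^esub> x = x"
      using cauchy_prod_monomial_left[of x \<one> "[]"] x by (auto simp: fun_eq_iff cl)
    show "x \<otimes>\<^bsub>?P\<^esub> \<one>\<^bsub>?P\<^esub> = x"
      using cauchy_prod_monomial_right[of x \<one> "[]"] x by (auto simp: fun_eq_iff cl)
  qed (auto simp: fun_eq_iff cl cauchy_prod_assoc intro!: power_series_mult_closed)
qed (auto simp: fun_eq_iff cauchy_prod_add_left cauchy_prod_add_right power_series_carrier)

text \<open>The additive inverse of a ring is specified only through its group law, so the pointwise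
  formula comes from uniqueness of inverses.\<close>

lemma power_series_minus:
  assumes "f \<in> carrier (power_series R X)"
  shows "\<ominus>\<^bsub>power_series R X\<^esub> f = (\<lambda>w. \<ominus> f w)"
proof -
  interpret P: ring "power_series R X" by (rule ring_power_series)
  have "(\<lambda>w. \<ominus> f w) \<oplus>\<^bsub>power_series R X\<^esub> f = \<zero>\<^bsub>power_series R X\<^esub>"
    using assms by (simp add: power_series_carrier l_neg)
  then show ?thesis
    using P.minus_equality assms power_series_uminus_closed by blast
qed

lemma subring_free_algebra: "subring (carrier (free_algebra R X)) (power_series R X)"
proof -
  interpret P: ring "power_series R X" by (rule ring_power_series)
  have cl: "f w \<in> carrier R" if "f \<in> carrier (power_series R X)" for f w
    using that by (simp add: power_series_carrier)
  show ?thesis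
  proof (rule P.subringI)
    show "\<one>\<^bsub>power_series R X\<^esub> \<in> carrier (free_algebra R X)"
      by (simp add: monomial_in_free_algebra)
    show "\<ominus>\<^bsub>power_series R X\<^esub> f \<in> carrier (free_algebra R X)"
      if "f \<in> carrier (free_algebra R X)" for f
      using that supp_uminus[of f] power_series_uminus_closed[of f]
      by (simp add: free_algebra_carrier power_series_minus cl)
    fix f g assume "f \<in> carrier (free_algebra R X)" "g \<in> carrier (free_algebra R X)"
    then have fg: "f \<in> carrier (power_series R X)" "g \<in> carrier (power_series R X)"
      "finite (supp R f)" "finite (supp R g)"
      by (simp_all add: free_algebra_carrier)
    have "finite (supp R (cauchy_prod R f g))"
      using fg by (intro finite_subset[OF supp_cauchy_prod]) (auto simp: cl)
    then show "f \<otimes>\<^bsub>power_series R X\<^esub> g \<in> carrier (free_algebra R X)"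
      using fg by (simp add: free_algebra_carrier power_series_mult_closed)
    have "finite (supp R (\<lambda>w. f w \<oplus> g w))"
      using fg by (intro finite_subset[OF supp_add]) (auto simp: cl)
    then show "f \<oplus>\<^bsub>power_series R X\<^esub> g \<in> carrier (free_algebra R X)"
      using fg by (simp add: free_algebra_carrier power_series_add_closed)
  qed (auto simp: free_algebra_carrier)
qed

lemma ring_free_algebra: "ring (free_algebra R X)"
  using ring.subring_is_ring[OF ring_power_series subring_free_algebra, of X]
  by (simp add: free_algebra_def)

lemma free_algebra_minus:
  assumes "f \<in> carrier (free_algebra R X)"
  shows "\<ominus>\<^bsub>free_algebra R X\<^esub> f = (\<lambda>w. \<ominus> f w)"
proof -
  interpret A: ring "free_algebra R X" by (rule ring_free_algebra)
  have f: "f w \<in> carrier R" for w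
    using assms by (simp add: free_algebra_carrier power_series_carrier)
  have "(\<lambda>w. \<ominus> f w) \<in> carrier (free_algebra R X)"
    using assms by (simp add: free_algebra_carrier power_series_uminus_closed supp_uminus f)
  moreover have "(\<lambda>w. \<ominus> f w) \<oplus>\<^bsub>free_algebra R X\<^esub> f = \<zero>\<^bsub>free_algebra R X\<^esub>"
    by (simp add: f l_neg)
  ultimately show ?thesis
    using A.minus_equality assms by blast
qed

text \<open>Multiplicativity holds because the empty word has a single factorization.\<close>

lemma const_coeff_power_series_hom: "ring_hom_ring (power_series R X) R const_coeff"
  by (rule ring_hom_ringI)
    (auto simp: ring_power_series ring_axioms const_coeff_def power_series_carrier
      cauchy_prod_Nil monomial_def)

lemma const_coeff_free_algebra_hom: "ring_hom_ring (free_algebra R X) R const_coeff"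
  by (rule ring_hom_ringI)
    (auto simp: ring_free_algebra ring_axioms const_coeff_def free_algebra_carrier
      power_series_carrier cauchy_prod_Nil monomial_def)

end

section \<open>Admissible orders are well-orders\<close>

locale admissible_order =
  fixes X :: "'x set" and r :: "'x list rel"
  assumes admissible: "admissible X r"
begin

lemma linear: "linear_order_on (lists X) r"
  using admissible by (simp add: admissible_def)

lemmas partial_order =
  partial_order_onD[OF linear[unfolded linear_order_on_def, THEN conjunct1]]

lemma mem_lists: "(u, v) \<in> r \<Longrightarrow> u \<in> lists X \<and> v \<in> lists X"
  using partial_order(4) by blast

lemma refl: "u \<in> lists X \<Longrightarrow> (u, u) \<in> r"
  using partial_order(1) by (rule refl_onD)

lemma trans: "(u, v) \<in> r \<Longrightarrow> (v, w) \<in> r \<Longrightarrow> (u, w) \<in> r"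
  using partial_order(2) by (rule transD)

lemma antisym: "(u, v) \<in> r \<Longrightarrow> (v, u) \<in> r \<Longrightarrow> u = v"
  using partial_order(3) by (rule antisymD)

lemma total: "u \<in> lists X \<Longrightarrow> v \<in> lists X \<Longrightarrow> (u, v) \<in> r \<or> (v, u) \<in> r"
  using linear refl[of u] by (cases "u = v") (simp_all add: linear_order_on_def total_on_def)

lemma Nil_le: "u \<in> lists X \<Longrightarrow> ([], u) \<in> r"
  using admissible refl[of "[]"] by (cases "u = []") (auto simp: admissible_def)

lemma less_context:
  "(m, n) \<in> r - Id \<Longrightarrow> u \<in> lists X \<Longrightarrow> v \<in> lists X \<Longrightarrow> (u @ m @ v, u @ n @ v) \<in> r - Id"
  using admissible mem_lists[of m n] by (simp add: admissible_def)

lemma le_context: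
  assumes "(m, n) \<in> r" "u \<in> lists X" "v \<in> lists X"
  shows "(u @ m @ v, u @ n @ v) \<in> r"
  using less_context[of m n u v] refl[of "u @ m @ v"] assms mem_lists[of m n] by auto

lemma append_mono:
  assumes "(m, m') \<in> r" "(n, n') \<in> r"
  shows "(m @ n, m' @ n') \<in> r"
  using le_context[of m m' "[]" n] le_context[of n n' m' "[]"] assms(1,2)[THEN mem_lists]
    assms trans[of "m @ n" "m' @ n"] by simp

text \<open>Each letter is at least \<open>[]\<close>, so inserting letters at any place never
  lowers a word. This ties the order to scattered subwords.\<close>

lemma subseq_imp_le:
  assumes "subseq u v" "v \<in> lists X"
  shows "(u, v) \<in> r"
  using assms
proof (induction rule: list_emb.induct)
  case (list_emb_Nil ys)
  then show ?case by (rule Nil_le)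
next
  case (list_emb_Cons xs ys y)
  then show ?case
    using append_mono[of "[]" "[y]" xs ys] Nil_le[of "[y]"] by auto
next
  case (list_emb_Cons2 x y xs ys)
  then show ?case
    using append_mono[of "[y]" "[y]" xs ys] refl[of "[y]"] by auto
qed

text \<open>A property of single sets of words rather than of the relation, so that it can be
  propagated through unions and concatenations.\<close>

definition well_ordered :: "'x list set \<Rightarrow> bool"
  where "well_ordered M \<longleftrightarrow> M \<subseteq> lists X \<and> (\<forall>Z\<subseteq>M. Z \<noteq> {} \<longrightarrow> (\<exists>z\<in>Z. \<forall>w\<in>Z. (z, w) \<in> r))"

lemma well_orderedE:
  assumes "well_ordered M" "Z \<subseteq> M" "Z \<noteq> {}"
  obtains z where "z \<in> Z" "\<And>w. w \<in> Z \<Longrightarrow> (z, w) \<in> r"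
proof -
  have "\<exists>z\<in>Z. \<forall>w\<in>Z. (z, w) \<in> r"
    using assms by (simp add: well_ordered_def)
  then show thesis using that by blast
qed

lemma well_ordered_subset: "well_ordered N \<Longrightarrow> M \<subseteq> N \<Longrightarrow> well_ordered M"
  unfolding well_ordered_def by (meson order_trans)

lemma well_ordered_singleton: "u \<in> lists X \<Longrightarrow> well_ordered {u}"
  using refl by (auto simp: well_ordered_def subset_singleton_iff)

lemma well_ordered_Un:
  assumes M: "well_ordered M" and N: "well_ordered N"
  shows "well_ordered (M \<union> N)"
  unfolding well_ordered_def
proof (intro conjI allI impI)
  show "M \<union> N \<subseteq> lists X"
    using assms by (simp add: well_ordered_def)
  fix Z assume Z: "Z \<subseteq> M \<union> N" "Z \<noteq> {}"
  show "\<exists>z\<in>Z. \<forall>w\<in>Z. (z, w) \<in> r"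
  proof (cases "Z \<inter> M = {} \<or> Z \<inter> N = {}")
    case True
    then have "Z \<subseteq> N \<or> Z \<subseteq> M" using Z by blast
    then show ?thesis using assms Z(2) unfolding well_ordered_def by blast
  next
    case False
    obtain x where x: "x \<in> Z \<inter> M" "\<And>w. w \<in> Z \<inter> M \<Longrightarrow> (x, w) \<in> r"
      using well_orderedE[OF M, of "Z \<inter> M"] False by blast
    obtain y where y: "y \<in> Z \<inter> N" "\<And>w. w \<in> Z \<inter> N \<Longrightarrow> (y, w) \<in> r"
      using well_orderedE[OF N, of "Z \<inter> N"] False by blast
    have "(x, y) \<in> r \<or> (y, x) \<in> r"
      using x y total mem_lists by blast
    then show ?thesis
    proof
      assume "(x, y) \<in> r"
      then have "\<forall>w\<in>Z. (x, w) \<in> r"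
        using x y Z trans by blast
      with x show ?thesis by blast
    next
      assume "(y, x) \<in> r"
      then have "\<forall>w\<in>Z. (y, w) \<in> r"
        using x y Z trans by blast
      with y show ?thesis by blast
    qed
  qed
qed

definition products :: "'x list set \<Rightarrow> 'x list set \<Rightarrow> 'x list set"
  where "products M N = {m @ n | m n. m \<in> M \<and> n \<in> N}"

text \<open>A set of products without least element would yield strictly decreasing second factors:
  among the products below a given one, take one with least first factor.\<close>

lemma well_ordered_products:
  assumes M: "well_ordered M" and N: "well_ordered N"
  shows "well_ordered (products M N)"
  unfolding well_ordered_def
proof (intro conjI allI impI)
  have MX: "M \<subseteq> lists X" and NX: "N \<subseteq> lists X"
    using assms by (auto simp: well_ordered_def)
  show PX: "products M N \<subseteq> lists X"
    using MX NX by (force simp: products_def)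
  fix Z assume Z: "Z \<subseteq> products M N" "Z \<noteq> {}"
  show "\<exists>z\<in>Z. \<forall>w\<in>Z. (z, w) \<in> r"
  proof (rule ccontr)
    assume no_min: "\<not> (\<exists>z\<in>Z. \<forall>w\<in>Z. (z, w) \<in> r)"
    \<comment> \<open>Goodness makes first factors monotone: a product in \<open>Z\<close> at or
      below a good one cannot have a smaller first factor.\<close>
    define good where "good m n \<longleftrightarrow> m \<in> M \<and> n \<in> N \<and> m @ n \<in> Z \<and>
      (\<forall>m'\<in>M. \<forall>n'\<in>N. m' @ n' \<in> Z \<and> (m' @ n', m @ n) \<in> r \<longrightarrow> (m, m') \<in> r)" for m n
    have ex_good: "\<exists>m n. good m n \<and> (m @ n, z) \<in> r" if z: "z \<in> Z" for z
    proof -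
      \<comment> \<open>The least first factor in \<open>?F\<close> gives a good pair, since
        whatever lies in \<open>Z\<close> below \<open>m @ n\<close> also lies below
        \<open>z\<close>.\<close>
      let ?F = "{m \<in> M. \<exists>n\<in>N. m @ n \<in> Z \<and> (m @ n, z) \<in> r}"
      have "(z, z) \<in> r" using refl z Z PX by blast
      then have "?F \<noteq> {}" using z Z unfolding products_def by fastforce
      then obtain m where m: "m \<in> ?F" "\<And>m'. m' \<in> ?F \<Longrightarrow> (m, m') \<in> r"
        using well_orderedE[OF M, of ?F] by blast
      then obtain n where n: "n \<in> N" "m @ n \<in> Z" "(m @ n, z) \<in> r" by blast
      have "good m n"
        using m n trans unfolding good_def by blast
      with n show ?thesis by blast
    qed
    let ?S = "{n. \<exists>m. good m n}"
    have "?S \<noteq> {}" using ex_good Z(2) by blast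
    moreover have "?S \<subseteq> N" by (auto simp: good_def)
    ultimately obtain n where n: "n \<in> ?S" "\<And>n'. n' \<in> ?S \<Longrightarrow> (n, n') \<in> r"
      using well_orderedE[OF N, of ?S] by blast
    then obtain m where mn: "good m n" by blast
    then have mnZ: "m @ n \<in> Z" by (simp add: good_def)
    then obtain z where z: "z \<in> Z" "(m @ n, z) \<notin> r" using no_min by blast
    then have z_less: "(z, m @ n) \<in> r" using total mnZ Z PX by blast
    obtain m' n' where mn': "good m' n'" "(m' @ n', z) \<in> r" using ex_good[OF z(1)] by blast
    have "(m' @ n', m @ n) \<in> r" using mn' z_less trans by blast
    then have "(m, m') \<in> r"
      using mn mn' unfolding good_def by blast
    moreover have "(n, n') \<in> r" using n mn' by blast
    \<comment> \<open>The first factor is no smaller by goodness of \<open>m @ n\<close>, the second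
      by the choice of \<open>n\<close>; so \<open>m' @ n'\<close> cannot lie below
      \<open>z\<close>, which is strictly below \<open>m @ n\<close>.\<close>
    ultimately have "(m @ n, m' @ n') \<in> r" by (rule append_mono)
    then show False using mn' z trans by blast
  qed
qed

text \<open>Cut \<open>v\<close> at the first occurrence of \<open>a\<close>: the part before it is
  free of \<open>a\<close>, and the part after it must avoid \<open>w\<close>, since otherwise the
  \<open>a\<close> would complete an embedding of \<open>a # w\<close>.\<close>

lemma lists_avoid_Cons:
  assumes "v \<in> lists Y" "\<not> subseq (a # w) v"
  shows "v \<in> lists (Y - {a}) \<union>
    products (lists (Y - {a})) (products {[a]} {v \<in> lists Y. \<not> subseq w v})"
proof (cases "a \<in> set v")
  case True
  then obtain x y where v: "v = x @ a # y" "a \<notin> set x"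
    using split_list_first[of a v] by blast
  have "\<not> subseq w y"
  proof
    assume "subseq w y"
    then have "subseq (a # w) (a # y)" by simp
    then have "subseq (a # w) (x @ a # y)" by (rule list_emb_append2)
    with assms(2) v(1) show False by simp
  qed
  moreover have "x \<in> lists (Y - {a})" "y \<in> lists Y"
    using v assms(1) by auto
  moreover have "v = x @ [a] @ y" using v(1) by simp
  ultimately show ?thesis unfolding products_def by blast
next
  case False
  then show ?thesis using assms by auto
qed

text \<open>An admissible order extends the scattered-subword order, so this is Higman's lemma for
  words over a finite alphabet: all words below a given \<open>w\<close> avoid \<open>w\<close> as a scattered subword,
  and such words are products of boundedly many words over smaller alphabets and letters.\<close>

lemma well_ordered_lists:
  assumes "finite Y" "Y \<subseteq> X"
  shows "well_ordered (lists Y)"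
  using assms
proof (induction Y rule: finite_psubset_induct)
  case (psubset Y)
  \<comment> \<open>Inner induction on the forbidden word. For \<open>[]\<close> the set is empty;
    for \<open>a # w\<close> the outer hypothesis covers the alphabet without
    \<open>a\<close>.\<close>
  have avoid: "well_ordered {v \<in> lists Y. \<not> subseq w v}" if "w \<in> lists Y" for w
    using that
  proof (induction w)
    case Nil
    then show ?case by (simp add: well_ordered_def)
  next
    case (Cons a w)
    then have a: "a \<in> Y" "w \<in> lists Y" by auto
    have smaller: "well_ordered (lists (Y - {a}))"
      using psubset a by (intro psubset.IH) auto
    have "well_ordered (lists (Y - {a}) \<union>
        products (lists (Y - {a})) (products {[a]} {v \<in> lists Y. \<not> subseq w v}))"
      using a psubset.prems Cons
      by (intro well_ordered_Un well_ordered_products well_ordered_singleton smaller) auto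
    then show ?case
    proof (rule well_ordered_subset, intro subsetI)
      fix v assume "v \<in> {v \<in> lists Y. \<not> subseq (a # w) v}"
      then show "v \<in> lists (Y - {a}) \<union>
          products (lists (Y - {a})) (products {[a]} {v \<in> lists Y. \<not> subseq w v})"
        by (intro lists_avoid_Cons) simp_all
    qed
  qed
  show ?case
    unfolding well_ordered_def
  proof (intro conjI allI impI)
    show X: "lists Y \<subseteq> lists X" using psubset.prems by (rule lists_mono)
    fix Z assume Z: "Z \<subseteq> lists Y" "Z \<noteq> {}"
    then obtain w where w: "w \<in> Z" by blast
    \<comment> \<open>Words of \<open>Z\<close> in which \<open>w\<close> embeds lie above
      \<open>w\<close>, so only \<open>w\<close> and the words in \<open>?Z\<close> compete for the
      minimum.\<close>
    let ?Z = "{z \<in> Z. \<not> subseq w z}"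
    show "\<exists>z\<in>Z. \<forall>v\<in>Z. (z, v) \<in> r"
    proof (cases "?Z = {}")
      case True
      then have "(w, v) \<in> r" if "v \<in> Z" for v
        using that subseq_imp_le[of w v] Z(1) X by blast
      then show ?thesis using w by blast
    next
      case False
      have "well_ordered ({w} \<union> {v \<in> lists Y. \<not> subseq w v})"
        by (intro well_ordered_Un well_ordered_singleton avoid) (use w Z X in blast)+
      then have "well_ordered (insert w ?Z)"
        by (rule well_ordered_subset) (use Z in blast)
      then obtain z where z: "z \<in> insert w ?Z" "\<And>v. v \<in> insert w ?Z \<Longrightarrow> (z, v) \<in> r"
        using well_orderedE[of _ "insert w ?Z"] by blast
      have "(z, v) \<in> r" if v: "v \<in> Z" for v
      proof (cases "subseq w v")
        case True
        then have "(w, v) \<in> r" using v Z(1) X subseq_imp_le[of w v] by blast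
        with z(2)[of w] show ?thesis using trans by blast
      next
        case False
        with v show ?thesis using z(2) by blast
      qed
      with z w show ?thesis by blast
    qed
  qed
qed

lemma wf_less: "finite X \<Longrightarrow> wf (r - Id)"
proof (rule wfI_min)
  fix x and Q :: "'x list set"
  assume "finite X" and x: "x \<in> Q"
  then have wo: "well_ordered (lists X)" by (intro well_ordered_lists) auto
  show "\<exists>z\<in>Q. \<forall>y. (y, z) \<in> r - Id \<longrightarrow> y \<notin> Q"
  proof (cases "Q \<inter> lists X = {}")
    case True
    \<comment> \<open>The relation only involves words over \<open>X\<close>, so any element of
      \<open>Q\<close> is minimal here.\<close>
    then show ?thesis using x mem_lists by blast
  next
    case False
    then obtain z where "z \<in> Q \<inter> lists X" "\<And>w. w \<in> Q \<inter> lists X \<Longrightarrow> (z, w) \<in> r"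
      using well_orderedE[OF wo, of "Q \<inter> lists X"] by blast
    then show ?thesis using antisym mem_lists by blast
  qed
qed

section \<open>Extremal words of finite supports\<close>

lemma finite_has_max:
  assumes "finite F" "F \<noteq> {}" "F \<subseteq> lists X"
  shows "\<exists>m\<in>F. \<forall>w\<in>F. (w, m) \<in> r"
  using assms
proof (induction rule: finite_ne_induct)
  case (singleton x)
  then show ?case using refl by auto
next
  case (insert x F)
  then obtain m where m: "m \<in> F" "\<forall>w\<in>F. (w, m) \<in> r" by auto
  then show ?case
    using total[of x m] refl[of x] trans[of _ m x] insert.prems by blast
qed

lemma finite_has_min:
  assumes "finite F" "F \<noteq> {}" "F \<subseteq> lists X"
  shows "\<exists>m\<in>F. \<forall>w\<in>F. (m, w) \<in> r"
  using assms
proof (induction rule: finite_ne_induct)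
  case (singleton x)
  then show ?case using refl by auto
next
  case (insert x F)
  then obtain m where m: "m \<in> F" "\<forall>w\<in>F. (m, w) \<in> r" by auto
  then show ?case
    using total[of x m] refl[of x] trans[of x m] insert.prems by blast
qed

text \<open>\<open>MT\<close> is a definite description: existence of the maximum comes from the
  finite support, uniqueness from antisymmetry.\<close>

lemma MT_props:
  assumes "p \<in> carrier (free_algebra K X)" "supp K p \<noteq> {}"
  shows "MT K r p \<in> supp K p" "\<And>w. w \<in> supp K p \<Longrightarrow> (w, MT K r p) \<in> r"
proof -
  have fin: "finite (supp K p)" "supp K p \<subseteq> lists X"
    using assms(1) by (auto simp: free_algebra_def power_series_def)
  have "\<exists>!m. m \<in> supp K p \<and> (\<forall>w\<in>supp K p. (w, m) \<in> r)"
    using finite_has_max[OF fin(1) assms(2) fin(2)] antisym by blast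
  from theI'[OF this]
  show "MT K r p \<in> supp K p" "\<And>w. w \<in> supp K p \<Longrightarrow> (w, MT K r p) \<in> r"
    by (simp_all add: MT_def)
qed

text \<open>Meant for a polynomial viewed as a power series; its finite support supplies the
  minimum.\<close>

lemma mt_in_supp:
  assumes "p \<in> carrier (free_algebra K X)" "supp K p \<noteq> {}"
  shows "mt K r p \<in> supp K p"
proof -
  have fin: "finite (supp K p)" "supp K p \<subseteq> lists X"
    using assms(1) by (auto simp: free_algebra_def power_series_def)
  have "\<exists>!m. m \<in> supp K p \<and> (\<forall>w\<in>supp K p. (m, w) \<in> r)"
    using finite_has_min[OF fin(1) assms(2) fin(2)] antisym by blast
  from theI'[OF this] show ?thesis
    by (simp add: mt_def)
qed

end

section \<open>Ideal powers, adic closure and residual nilpotence of quotients\<close>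

lemma ideals_set_simps [simp]:
  "mult (ideals_set A) = ideal_prod A" "one (ideals_set A) = carrier A"
  by (simp_all add: ideals_set_def)

section \<open>Powers of ideals and the adic topology\<close>

context ring
begin

lemma ideal_power_is_ideal:
  "ideal I R \<Longrightarrow> ideal (I [^]\<^bsub>ideals_set R\<^esub> (n::nat)) R"
  by (induction n) (simp_all add: oneideal ideal_prod_is_ideal)

lemma ideal_power_antimono:
  fixes m n :: nat
  assumes "ideal I R" "m \<le> n"
  shows "I [^]\<^bsub>ideals_set R\<^esub> n \<subseteq> I [^]\<^bsub>ideals_set R\<^esub> m"
  using assms(2)
proof (induction n rule: dec_induct)
  case (step n)
  then show ?case
    using ideal_prod_inter[OF ideal_power_is_ideal[OF assms(1), of n] assms(1)]
    by auto
qed simp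

text \<open>Induction on the generation of the open set. For an intersection the larger exponent
  serves, as powers decrease; a generating coset that contains \<open>x\<close> equals the coset of
  \<open>x\<close>.\<close>

lemma adic_neighbourhood:
  assumes "ideal I R" "openin (adic_topology R I) U" "x \<in> U" "x \<in> carrier R"
  shows "\<exists>n::nat. I [^]\<^bsub>ideals_set R\<^esub> n +> x \<subseteq> U"
proof -
  have "generate_topology_on
      {I [^]\<^bsub>ideals_set R\<^esub> n +> a | (n::nat) a. a \<in> carrier R} U"
    using assms(2) by (simp add: adic_topology_def openin_topology_generated_by_iff)
  then show ?thesis
    using assms(3)
  proof induction
    case (Int U V)
    then obtain m n where mn: "I [^]\<^bsub>ideals_set R\<^esub> (m::nat) +> x \<subseteq> U"
      "I [^]\<^bsub>ideals_set R\<^esub> (n::nat) +> x \<subseteq> V" by auto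
    have "I [^]\<^bsub>ideals_set R\<^esub> max m n +> x \<subseteq> I [^]\<^bsub>ideals_set R\<^esub> k +> x"
      if "k \<le> max m n" for k
      using ideal_power_antimono[OF assms(1) that] by (auto simp: a_r_coset_def')
    from this[of m] this[of n] mn show ?case
      by (intro exI[of _ "max m n"]) auto
  next
    case (Basis U)
    then obtain n :: nat and a where U: "U = I [^]\<^bsub>ideals_set R\<^esub> n +> a" "a \<in> carrier R"
      by blast
    have "subgroup (I [^]\<^bsub>ideals_set R\<^esub> n) (add_monoid R)"
      using ideal_power_is_ideal[OF assms(1)] by (simp add: additive_subgroup.a_subgroup ideal.axioms(1))
    then show ?case
      using a_repr_independence Basis U by blast
  qed blast+
qed

lemma in_adic_closure:
  assumes "ideal I R" "x \<in> carrier R"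
    and approx: "\<And>n::nat. \<exists>t\<in>T. t \<in> I [^]\<^bsub>ideals_set R\<^esub> n +> x"
  shows "x \<in> adic_topology R I closure_of T"
proof -
  \<comment> \<open>The zeroth power is the whole ring, so \<open>x\<close> lies in a generating set
    and hence in the topological space.\<close>
  have "x \<in> I [^]\<^bsub>ideals_set R\<^esub> (0::nat) +> x"
    using assms(2) by (auto simp: a_r_coset_def' intro: bexI[of _ "\<zero>"])
  then have "x \<in> topspace (adic_topology R I)"
    using assms(2) unfolding adic_topology_def topology_generated_by_topspace by blast
  moreover have "\<exists>t\<in>T. t \<in> U" if U: "x \<in> U" "openin (adic_topology R I) U" for U
  proof -
    obtain n :: nat where "I [^]\<^bsub>ideals_set R\<^esub> n +> x \<subseteq> U"
      using adic_neighbourhood[OF assms(1) U(2,1) assms(2)] by blast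
    with approx[of n] show ?thesis by blast
  qed
  ultimately show ?thesis
    unfolding in_closure_of by blast
qed

text \<open>Choosing representatives turns sums of products of cosets into cosets of sums of
  products; hence a rule induction on \<open>ideal_prod\<close> inside the induction on
  \<open>n\<close>.\<close>

lemma quotient_power_subset:
  assumes "ideal J R" "ideal I R"
  shows "((+>) J ` I) [^]\<^bsub>ideals_set (R Quot J)\<^esub> (n::nat)
    \<subseteq> (+>) J ` (I [^]\<^bsub>ideals_set R\<^esub> n)"
proof (induction n)
  case 0
  show ?case
    by (auto simp: FactRing_simps)
next
  case (Suc n)
  let ?M = "I [^]\<^bsub>ideals_set R\<^esub> n"
  have carr: "?M \<subseteq> carrier R" "I \<subseteq> carrier R" "ideal_prod R ?M I \<subseteq> carrier R"
    using ideal.Icarr[OF ideal_power_is_ideal[OF assms(2)]] ideal.Icarr[OF assms(2)]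
      ideal_prod_in_carrier[OF ideal_power_is_ideal[OF assms(2)] assms(2)] by blast+
  have "C \<in> (+>) J ` ideal_prod R ?M I"
    if "C \<in> ideal_prod (R Quot J)
      (((+>) J ` I) [^]\<^bsub>ideals_set (R Quot J)\<^esub> n) ((+>) J ` I)" for C
    using that
  proof (induction rule: ideal_prod.induct)
    case (prod C D)
    then obtain a b where "a \<in> ?M" "b \<in> I" "C = J +> a" "D = J +> b"
      using Suc.IH by blast
    moreover from this have "a \<in> carrier R" "b \<in> carrier R" using carr by blast+
    ultimately show ?case
      by (intro image_eqI[of _ _ "a \<otimes> b"])
        (simp_all add: FactRing_def ideal.rcoset_mult_add[OF assms(1)] ideal_prod.prod)
  next
    case (sum C D)
    then obtain a b where "a \<in> ideal_prod R ?M I" "b \<in> ideal_prod R ?M I"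
      "C = J +> a" "D = J +> b" by blast
    moreover from this have "a \<in> carrier R" "b \<in> carrier R" using carr by blast+
    ultimately show ?case
      by (intro image_eqI[of _ _ "a \<oplus> b"])
        (simp_all add: FactRing_def ideal.a_rcos_sum[OF assms(1)] ideal_prod.sum)
  qed
  then show ?case
    by auto
qed

text \<open>Asking only for \<open>\<zero> \<in> I\<close> lets this apply in the quotient without
  first showing that its augmentation ideal is an ideal.\<close>

lemma zero_in_ideal_power:
  assumes "\<zero> \<in> I"
  shows "\<zero> \<in> I [^]\<^bsub>ideals_set R\<^esub> (n::nat)"
proof (induction n)
  case (Suc n)
  then show ?case
    using ideal_prod.prod[OF Suc assms, of R] by simp
qed simp

end

section \<open>The augmentation of a quotient\<close>

lemma carrier_FactRing: "carrier (A Quot J) = (+>\<^bsub>A\<^esub>) J ` carrier A"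
  by (auto simp: FactRing_def A_RCOSETS_def')

text \<open>As \<epsilon> vanishes on \<open>J\<close>, it is constant on every coset; so
  \<open>the_elem\<close> in \<open>induced_aug\<close> is applied to a singleton.\<close>

lemma aug_ideal_quotient:
  assumes "ring_hom_ring A K \<epsilon>" "ideal J A" "J \<subseteq> aug_ideal K A \<epsilon>"
  shows "aug_ideal K (A Quot J) (induced_aug \<epsilon>) = (+>\<^bsub>A\<^esub>) J ` aug_ideal K A \<epsilon>"
proof -
  interpret \<epsilon>: ring_hom_ring A K \<epsilon> by fact
  interpret J: ideal J A by fact
  have induced: "induced_aug \<epsilon> (J +>\<^bsub>A\<^esub> a) = \<epsilon> a" if a: "a \<in> carrier A" for a
  proof -
    have "\<epsilon> x = \<epsilon> a" if x: "x \<in> J +>\<^bsub>A\<^esub> a" for x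
    proof -
      obtain j where j: "j \<in> J" "x = j \<oplus>\<^bsub>A\<^esub> a"
        using x unfolding a_r_coset_def' by blast
      then have "j \<in> carrier A" "\<epsilon> j = \<zero>\<^bsub>K\<^esub>"
        using assms(3) unfolding aug_ideal_def a_kernel_def' by blast+
      then show ?thesis using a j(2) by simp
    qed
    moreover have "a \<in> J +>\<^bsub>A\<^esub> a" using a by (rule J.a_rcos_self)
    ultimately have "\<epsilon> ` (J +>\<^bsub>A\<^esub> a) = {\<epsilon> a}" by blast
    then show ?thesis by (simp add: induced_aug_def)
  qed
  have "aug_ideal K (A Quot J) (induced_aug \<epsilon>)
      = {C \<in> (+>\<^bsub>A\<^esub>) J ` carrier A. induced_aug \<epsilon> C = \<zero>\<^bsub>K\<^esub>}"
    unfolding aug_ideal_def a_kernel_def' carrier_FactRing by (rule refl)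
  also have "\<dots> = (+>\<^bsub>A\<^esub>) J ` aug_ideal K A \<epsilon>"
    unfolding aug_ideal_def a_kernel_def' using induced by auto
  finally show ?thesis .
qed

text \<open>The premise \<open>separated\<close> says that the intersection of all
  \<open>J + I^n\<close> lies in \<open>J\<close>, that is, \<open>J\<close> is closed in the adic
  topology of \<open>A\<close>.\<close>

lemma residually_nilpotent_quotientI:
  assumes hom: "ring_hom_ring A K \<epsilon>" and J: "ideal J A" "J \<subseteq> aug_ideal K A \<epsilon>"
    and separated: "\<And>a. \<lbrakk>a \<in> carrier A;
      \<And>n::nat. \<exists>j\<in>J. \<exists>i\<in>aug_ideal K A \<epsilon> [^]\<^bsub>ideals_set A\<^esub> n. a = j \<oplus>\<^bsub>A\<^esub> i\<rbrakk> \<Longrightarrow> a \<in> J"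
  shows "residually_nilpotent K (A Quot J) (induced_aug \<epsilon>)"
proof -
  interpret \<epsilon>: ring_hom_ring A K \<epsilon> by fact
  interpret J: ideal J A by fact
  interpret Q: ring "A Quot J" by (rule J.quotient_is_ring)
  let ?I = "aug_ideal K A \<epsilon>"
  let ?I' = "aug_ideal K (A Quot J) (induced_aug \<epsilon>)"
  have I: "ideal ?I A"
    unfolding aug_ideal_def by (rule \<epsilon>.kernel_is_ideal)
  have zero: "\<zero>\<^bsub>A Quot J\<^esub> = J" by (simp add: FactRing_def)
  have I': "?I' = (+>\<^bsub>A\<^esub>) J ` ?I"
    using aug_ideal_quotient[OF hom J] .
  have "J \<in> ?I'"
    unfolding I' using \<epsilon>.R.a_rcos_zero[OF J(1), of "\<zero>\<^bsub>A\<^esub>"] ideal.axioms(1)[OF I]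
    by (metis J.zero_closed additive_subgroup.zero_closed imageI)
  then have J_in: "J \<in> ?I' [^]\<^bsub>ideals_set (A Quot J)\<^esub> n" for n :: nat
    using Q.zero_in_ideal_power[of ?I'] by (simp add: zero)
  have "C = J" if C: "\<And>n. n \<ge> 1 \<Longrightarrow> C \<in> ?I' [^]\<^bsub>ideals_set (A Quot J)\<^esub> (n::nat)" for C
  proof -
    have rep: "\<exists>i\<in>?I [^]\<^bsub>ideals_set A\<^esub> (n::nat). C = J +>\<^bsub>A\<^esub> i" if "n \<ge> 1" for n
      using C[OF that] \<epsilon>.R.quotient_power_subset[OF J(1) I, of n] by (auto simp: I')
    have Ipow: "i \<in> carrier A" if "i \<in> ?I [^]\<^bsub>ideals_set A\<^esub> (n::nat)" for i n
      using that ideal.Icarr[OF \<epsilon>.R.ideal_power_is_ideal[OF I]] by blast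
    \<comment> \<open>One representative of \<open>C\<close> is fixed; the representatives in the
      various powers then differ from it by elements of \<open>J\<close>.\<close>
    obtain a where a: "a \<in> carrier A" "C = J +>\<^bsub>A\<^esub> a"
      using rep[of 1] Ipow by blast
    have "\<exists>j\<in>J. \<exists>i\<in>?I [^]\<^bsub>ideals_set A\<^esub> n. a = j \<oplus>\<^bsub>A\<^esub> i" for n :: nat
    proof -
      \<comment> \<open>Representatives are available from exponent 1 on, so exponent
        \<open>Suc n\<close> is used to cover \<open>n = 0\<close> as well.\<close>
      obtain i where i: "i \<in> ?I [^]\<^bsub>ideals_set A\<^esub> Suc n" "C = J +>\<^bsub>A\<^esub> i"
        using rep[of "Suc n"] by auto
      have "i \<in> ?I [^]\<^bsub>ideals_set A\<^esub> n"
        using \<epsilon>.R.ideal_power_antimono[OF I, of n "Suc n"] i(1) by auto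
      moreover have "a \<in> J +>\<^bsub>A\<^esub> i"
        using J.a_rcos_self a i by metis
      ultimately show ?thesis
        by (auto simp: a_r_coset_def')
    qed
    then have "a \<in> J" using separated a by blast
    then show "C = J" using a \<epsilon>.R.a_rcos_zero J(1) by simp
  qed
  then show ?thesis
    using J_in by (auto simp: residually_nilpotent_def zero)
qed

section \<open>Normal forms\<close>

context ring
begin

text \<open>The contraction of the ideal of power series to the polynomials is an ideal there and
  contains \<open>T\<close>, so minimality applies.\<close>

lemma genideal_free_algebra_subset:
  assumes "T \<subseteq> carrier (free_algebra R X)"
  shows "Idl\<^bsub>free_algebra R X\<^esub> T \<subseteq> Idl\<^bsub>power_series R X\<^esub> T"
proof -
  let ?A = "free_algebra R X" and ?P = "power_series R X"
  interpret A: ring ?A by (rule ring_free_algebra)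
  interpret P: ring ?P by (rule ring_power_series)
  have AP: "carrier ?A \<subseteq> carrier ?P" by (auto simp: free_algebra_carrier)
  interpret I: ideal "Idl\<^bsub>?P\<^esub> T" ?P
    using assms AP by (intro P.genideal_ideal) blast
  let ?J = "Idl\<^bsub>?P\<^esub> T \<inter> carrier ?A"
  have "ideal ?J ?A"
  proof (rule idealI)
    show "ring ?A" by (rule ring_free_algebra)
    show "subgroup ?J (add_monoid ?A)"
    proof (rule A.add.subgroupI)
      show "?J \<noteq> {}" using I.zero_closed A.zero_closed by auto
      fix f assume f: "f \<in> ?J"
      \<comment> \<open>Inverses are taken in two different rings; both are computed
        coefficientwise.\<close>
      then have "\<ominus>\<^bsub>?P\<^esub> f = \<ominus>\<^bsub>?A\<^esub> f"
        using AP by (subst power_series_minus) (auto simp: free_algebra_minus)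
      then show "\<ominus>\<^bsub>?A\<^esub> f \<in> ?J"
        using f I.a_inv_closed[of f] by auto
    next
      fix f g assume "f \<in> ?J" "g \<in> ?J"
      then show "f \<oplus>\<^bsub>?A\<^esub> g \<in> ?J"
        using I.a_closed[of f g] A.a_closed[of f g] by simp
    qed auto
  next
    fix f g assume fg: "f \<in> ?J" "g \<in> carrier ?A"
    then show "g \<otimes>\<^bsub>?A\<^esub> f \<in> ?J" "f \<otimes>\<^bsub>?A\<^esub> g \<in> ?J"
      using I.I_l_closed[of f g] I.I_r_closed[of f g] A.m_closed[of f g] A.m_closed[of g f] AP
      by auto
  qed
  moreover have "T \<subseteq> ?J" using assms AP P.genideal_self[of T] by blast
  ultimately show ?thesis using A.genideal_minimal[of ?J T] by blast
qed

text \<open>The two rings share their operations, so whatever products and sums generate among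
  polynomials they also generate among power series.\<close>

lemma aug_ideal_power_subset:
  "aug_ideal R (free_algebra R X) const_coeff [^]\<^bsub>ideals_set (free_algebra R X)\<^esub> (n::nat)
    \<subseteq> aug_ideal R (power_series R X) const_coeff [^]\<^bsub>ideals_set (power_series R X)\<^esub> n"
proof (induction n)
  case 0
  then show ?case
    by (auto simp: free_algebra_carrier)
next
  case (Suc n)
  let ?A = "free_algebra R X" and ?P = "power_series R X"
  have sub: "aug_ideal R ?A const_coeff \<subseteq> aug_ideal R ?P const_coeff"
    by (auto simp: aug_ideal_def a_kernel_def' free_algebra_carrier)
  have mono: "f \<in> ideal_prod ?P M N" if "f \<in> ideal_prod ?A M' N'" "M' \<subseteq> M" "N' \<subseteq> N" for f M N M' N'
    using that
  proof (induction rule: ideal_prod.induct)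
    case (prod i j)
    then show ?case using ideal_prod.prod[of i M j N ?P] by auto
  next
    case (sum f g)
    then show ?case using ideal_prod.sum[of f ?P M N g] by auto
  qed
  show ?case
    by (auto intro: mono[OF _ Suc sub])
qed

end

text \<open>Division with remainder, by well-founded induction on the leading word: the leading term
  is either cancelled by a multiple of some \<open>t \<in> T\<close> or moved to the
  remainder.\<close>

lemma (in admissible_order) normal_form:
  assumes K: "ring K" and "finite X" and T: "T \<subseteq> carrier (free_algebra K X)"
    and monic: "\<And>p. p \<in> T \<Longrightarrow> MT_monic K r p" and "p \<in> carrier (free_algebra K X)"
  shows "\<exists>j\<in>Idl\<^bsub>free_algebra K X\<^esub> T. \<exists>q\<in>carrier (free_algebra K X).
    p = j \<oplus>\<^bsub>free_algebra K X\<^esub> q \<and> supp K q \<inter> multiples X (MT K r ` T) = {}"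
    (is "?D p")
proof -
  interpret K: ring K by fact
  let ?A = "free_algebra K X"
  interpret A: ring ?A by (rule K.ring_free_algebra)
  interpret J: ideal "Idl\<^bsub>?A\<^esub> T" ?A by (rule A.genideal_ideal[OF T])
  have coeff: "f w \<in> carrier K" and supp_lists: "supp K f \<subseteq> lists X"
    if "f \<in> carrier ?A" for f w
    using that by (simp_all add: free_algebra_carrier power_series_carrier)
  \<comment> \<open>The zero polynomial has no leading word and stays outside the induction.\<close>
  have empty: "?D p" if "supp K p = {}" for p
  proof -
    have "p = \<zero>\<^bsub>?A\<^esub>" using that by (auto simp: supp_def fun_eq_iff)
    then show ?thesis
      using J.zero_closed A.zero_closed
      by (intro bexI[of _ "\<zero>\<^bsub>?A\<^esub>"] conjI) (auto simp: supp_def)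
  qed
  have "?D p" if "p \<in> carrier ?A" "supp K p \<noteq> {}" "MT K r p = m" for p m
    using wf_less[OF \<open>finite X\<close>] that
  proof (induction m arbitrary: p rule: wf_induct_rule)
    case (less m)
    note p = less.prems(1)
    define c where "c = p m"
    have c: "c \<in> carrier K" using p by (simp add: c_def coeff)
    have m: "m \<in> supp K p" and max: "\<And>w. w \<in> supp K p \<Longrightarrow> (w, m) \<in> r"
      using MT_props[OF less.prems(1,2)] less.prems(3) by auto
    then have mX: "m \<in> lists X" using supp_lists[OF p] by blast
    \<comment> \<open>Common to both cases: subtracting an \<open>s\<close> with the same leading
      term leaves only smaller words, to which the induction hypothesis applies. Afterwards
      \<open>s\<close> joins the ideal part \<open>j\<close> or the remainder
      \<open>q\<close>.\<close>
    have reduce: "\<exists>j\<in>Idl\<^bsub>?A\<^esub> T. \<exists>q\<in>carrier ?A.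
        p = (j \<oplus>\<^bsub>?A\<^esub> q) \<oplus>\<^bsub>?A\<^esub> s \<and> supp K q \<inter> multiples X (MT K r ` T) = {}"
      if s: "s \<in> carrier ?A" "s m = c" "\<And>w. w \<in> supp K s \<Longrightarrow> (w, m) \<in> r" for s
    proof -
      let ?p = "p \<ominus>\<^bsub>?A\<^esub> s"
      have p': "?p \<in> carrier ?A" using p s by simp
      have eq: "?p w = p w \<ominus>\<^bsub>K\<^esub> s w" for w
        using s by (simp add: A.minus_eq K.minus_eq K.free_algebra_minus)
      have "?p m = \<zero>\<^bsub>K\<^esub>"
        using s c by (simp add: eq c_def K.minus_eq K.r_neg)
      moreover have "w \<in> supp K p \<or> w \<in> supp K s" if "w \<in> supp K ?p" for w
        using that by (auto simp: supp_def eq K.minus_eq)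
      ultimately have below: "(w, m) \<in> r - Id" if "w \<in> supp K ?p" for w
        using that max[of w] s(3)[of w] by (auto simp: supp_def)
      have "?D ?p"
      proof (cases "supp K ?p = {}")
        case False
        then have "(MT K r ?p, m) \<in> r - Id" using MT_props(1)[OF p'] below by blast
        then show ?thesis using less.IH p' False by blast
      qed (rule empty)
      then obtain j q where jq: "j \<in> Idl\<^bsub>?A\<^esub> T" "q \<in> carrier ?A" "?p = j \<oplus>\<^bsub>?A\<^esub> q"
        "supp K q \<inter> multiples X (MT K r ` T) = {}" by blast
      have "p = ?p \<oplus>\<^bsub>?A\<^esub> s"
        using p s by (simp only: A.minus_eq A.a_assoc A.l_neg A.r_zero A.a_inv_closed)
      then show ?thesis using jq by metis
    qed
    show ?case
    proof (cases "m \<in> multiples X (MT K r ` T)")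
      case True
      then obtain u t v where utv: "m = u @ MT K r t @ v" "u \<in> lists X" "v \<in> lists X" "t \<in> T"
        by (auto simp: multiples_def)
      have t: "t \<in> carrier ?A" "supp K t \<noteq> {}" "t (MT K r t) = \<one>\<^bsub>K\<^esub>"
        using T monic[OF utv(4)] utv(4) by (auto simp: MT_monic_def)
      \<comment> \<open>\<open>s\<close> is \<open>c\<close> times \<open>u t v\<close>. Its
        coefficient at \<open>m\<close> is \<open>c\<close> because \<open>t\<close> is monic, and
        its other words stay below \<open>m\<close> by compatibility of the order with
        contexts.\<close>
      define U V where "U = monomial K c u" and "V = monomial K \<one>\<^bsub>K\<^esub> v"
      have UV: "U \<in> carrier ?A" "V \<in> carrier ?A"
        using utv c by (simp_all add: U_def V_def K.monomial_in_free_algebra)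
      define s where "s = U \<otimes>\<^bsub>?A\<^esub> (t \<otimes>\<^bsub>?A\<^esub> V)"
      have "t \<in> Idl\<^bsub>?A\<^esub> T" using A.genideal_self[OF T] utv by blast
      then have sJ: "s \<in> Idl\<^bsub>?A\<^esub> T"
        unfolding s_def using UV by (intro J.I_l_closed J.I_r_closed)
      have sm: "s m = c"
        using t c coeff[OF t(1)] coeff[OF UV(2)]
        by (simp add: s_def utv(1) U_def V_def K.cauchy_prod_monomial_left
            K.cauchy_prod_monomial_right)
      have "(w, m) \<in> r" if "w \<in> supp K s" for w
      proof -
        have "w \<in> supp K (cauchy_prod K U (t \<otimes>\<^bsub>?A\<^esub> V))"
          using that by (simp add: s_def)
        then obtain x y where xy: "w = x @ y" "x \<in> supp K U" "y \<in> supp K (t \<otimes>\<^bsub>?A\<^esub> V)"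
          by (rule K.supp_cauchy_prodE[OF coeff[OF UV(1)] coeff[OF A.m_closed[OF t(1) UV(2)]]])
        from xy(3) have "y \<in> supp K (cauchy_prod K t V)" by simp
        then obtain y1 y2 where "y = y1 @ y2" "y1 \<in> supp K t" "y2 \<in> supp K V"
          by (rule K.supp_cauchy_prodE[OF coeff[OF t(1)] coeff[OF UV(2)]])
        then have "w = u @ y1 @ v" "y1 \<in> supp K t"
          using xy K.supp_monomial[of c u] K.supp_monomial[of "\<one>\<^bsub>K\<^esub>" v]
          by (auto simp: U_def V_def)
        then show ?thesis
          using MT_props(2)[OF t(1,2)] le_context utv by auto
      qed
      then obtain j q where jq: "j \<in> Idl\<^bsub>?A\<^esub> T" "q \<in> carrier ?A"
        "p = (j \<oplus>\<^bsub>?A\<^esub> q) \<oplus>\<^bsub>?A\<^esub> s" "supp K q \<inter> multiples X (MT K r ` T) = {}"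
        using reduce[of s] J.Icarr[OF sJ] sm by blast
      have "p = (j \<oplus>\<^bsub>?A\<^esub> s) \<oplus>\<^bsub>?A\<^esub> q"
        unfolding jq(3) using J.Icarr[OF jq(1)] jq(2) J.Icarr[OF sJ] by (simp only: A.a_ac A.a_closed)
      then show ?thesis
        using jq J.a_closed[OF jq(1) sJ] by blast
    next
      case False
      \<comment> \<open>The leading word is already irreducible, so its term goes into the
        remainder.\<close>
      define s where "s = monomial K c m"
      have s: "s \<in> carrier ?A" "supp K s \<subseteq> {m}"
        using c mX K.supp_monomial[of c m]
        by (simp_all add: s_def K.monomial_in_free_algebra)
      obtain j q where jq: "j \<in> Idl\<^bsub>?A\<^esub> T" "q \<in> carrier ?A"
        "p = (j \<oplus>\<^bsub>?A\<^esub> q) \<oplus>\<^bsub>?A\<^esub> s" "supp K q \<inter> multiples X (MT K r ` T) = {}"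
        using reduce[of s] s refl[OF mX] by (auto simp: s_def monomial_def)
      have "p = j \<oplus>\<^bsub>?A\<^esub> (q \<oplus>\<^bsub>?A\<^esub> s)"
        unfolding jq(3) using J.Icarr[OF jq(1)] jq(2) s by (simp only: A.a_assoc)
      moreover have "supp K (q \<oplus>\<^bsub>?A\<^esub> s) \<inter> multiples X (MT K r ` T) = {}"
        using K.supp_add[of q s] jq(2,4) s False coeff by fastforce
      ultimately show ?thesis
        using jq(1) A.a_closed[OF jq(2) s(1)] by blast
    qed
  qed
  then show ?thesis
    using empty assms(5) by blast
qed

section \<open>Residual nilpotence from the two bases\<close>

theorem theorem3p2:
  fixes K :: "('k, 'm) ring_scheme"
    and X :: "'x set"
    and le preceq :: "'x list rel"
    and R S :: "('x list \<Rightarrow> 'k) set"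
  assumes "cring K"
    and "finite X"
    and "admissible X le"
    and "admissible X preceq"
    and "N_order_on (lists X) preceq"
    and "R \<subseteq> aug_ideal K (free_algebra K X) const_coeff"
    and "GS_basis_poly K X le R"
    and "S \<subseteq> aug_ideal K (power_series K X) const_coeff"
    and "GS_basis_series K X preceq S"
    and "closed_ideal K X R = closed_ideal K X S"
    and "MT K le ` R = mt K preceq ` S"
  shows "residually_nilpotent K
           (free_algebra K X Quot (Idl\<^bsub>free_algebra K X\<^esub> R))
           (induced_aug const_coeff)"
proof -
  interpret K: cring K by fact
  interpret le: admissible_order X le by unfold_locales fact
  interpret preceq: admissible_order X preceq by unfold_locales fact
  let ?A = "free_algebra K X" and ?P = "power_series K X"
  let ?J = "Idl\<^bsub>?A\<^esub> R"
  let ?IA = "aug_ideal K ?A const_coeff" and ?IP = "aug_ideal K ?P const_coeff"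
  interpret A: ring ?A by (rule K.ring_free_algebra)
  interpret P: ring ?P by (rule K.ring_power_series)
  have homA: "ring_hom_ring ?A K const_coeff" by (rule K.const_coeff_free_algebra_hom)
  have IP: "ideal ?IP ?P"
    unfolding aug_ideal_def
    by (rule ring_hom_ring.kernel_is_ideal[OF K.const_coeff_power_series_hom])
  have IA: "ideal ?IA ?A"
    unfolding aug_ideal_def by (rule ring_hom_ring.kernel_is_ideal[OF homA])
  have RA: "R \<subseteq> carrier ?A" and monic: "\<And>p. p \<in> R \<Longrightarrow> MT_monic K le p"
    using assms(7) by (auto simp: GS_basis_poly_def)
  interpret J: ideal ?J ?A by (rule A.genideal_ideal[OF RA])
  show ?thesis
  proof (rule residually_nilpotent_quotientI[OF homA J.ideal_axioms])
    \<comment> \<open>This makes the augmentation well defined on the quotient.\<close>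
    show "?J \<subseteq> ?IA" using A.genideal_minimal[OF IA assms(6)] .
    fix a assume a: "a \<in> carrier ?A"
      and approx: "\<And>n::nat. \<exists>j\<in>?J. \<exists>i\<in>?IA [^]\<^bsub>ideals_set ?A\<^esub> n. a = j \<oplus>\<^bsub>?A\<^esub> i"
    obtain j b where jb: "j \<in> ?J" "b \<in> carrier ?A" "a = j \<oplus>\<^bsub>?A\<^esub> b"
      "supp K b \<inter> multiples X (MT K le ` R) = {}"
      using le.normal_form[OF K.ring_axioms assms(2) RA monic a] by blast
    have bP: "b \<in> carrier ?P" using jb(2) by (simp add: free_algebra_carrier)
    have jA: "j \<in> carrier ?A" using jb(1) by (rule J.Icarr)
    have "b \<in> adic_topology ?P ?IP closure_of (Idl\<^bsub>?P\<^esub> R)"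
    proof (rule P.in_adic_closure[OF IP bP])
      fix n :: nat
      obtain j' i where ji: "j' \<in> ?J" "i \<in> ?IA [^]\<^bsub>ideals_set ?A\<^esub> n" "a = j' \<oplus>\<^bsub>?A\<^esub> i"
        using approx by blast
      have iA: "i \<in> carrier ?A" and mi: "\<ominus>\<^bsub>?A\<^esub> i \<in> ?IA [^]\<^bsub>ideals_set ?A\<^esub> n"
        using ji(2) ideal.Icarr[OF A.ideal_power_is_ideal[OF IA]]
          additive_subgroup.a_inv_closed[OF ideal.axioms(1)[OF A.ideal_power_is_ideal[OF IA]]]
          A.abelian_group_axioms by blast+
      have j'A: "j' \<in> carrier ?A" using ji(1) by (rule J.Icarr)
      \<comment> \<open>From \<open>j + b = j' + i\<close>: up to the element \<open>i\<close> of
        the n-th power, \<open>b\<close> equals an element of \<open>?J\<close>.\<close>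
      have b: "b = (\<ominus>\<^bsub>?A\<^esub> j \<oplus>\<^bsub>?A\<^esub> j') \<oplus>\<^bsub>?A\<^esub> i"
        using jb(2,3) ji(3) jA j'A iA
        by (metis A.a_assoc A.a_inv_closed A.r_neg2 A.r_neg1)
      have "\<ominus>\<^bsub>?A\<^esub> i \<oplus>\<^bsub>?A\<^esub> b = \<ominus>\<^bsub>?A\<^esub> j \<oplus>\<^bsub>?A\<^esub> j'"
        unfolding b using jA j'A iA
        by (metis A.a_assoc A.a_comm A.a_closed A.a_inv_closed A.r_neg1)
      moreover have "\<ominus>\<^bsub>?A\<^esub> j \<oplus>\<^bsub>?A\<^esub> j' \<in> ?J"
        using jb(1) ji(1) by (intro J.a_closed J.a_inv_closed)
      \<comment> \<open>Addition is the same function in both rings, so the approximant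
        \<open>b - i\<close> can be read as a power series in the coset of \<open>b\<close>.\<close>
      ultimately have "\<ominus>\<^bsub>?A\<^esub> i \<oplus>\<^bsub>?P\<^esub> b \<in> Idl\<^bsub>?P\<^esub> R"
        using K.genideal_free_algebra_subset[OF RA] by auto
      moreover have "\<ominus>\<^bsub>?A\<^esub> i \<oplus>\<^bsub>?P\<^esub> b \<in> ?IP [^]\<^bsub>ideals_set ?P\<^esub> n +>\<^bsub>?P\<^esub> b"
        using mi K.aug_ideal_power_subset unfolding a_r_coset_def' by blast
      ultimately show "\<exists>t\<in>Idl\<^bsub>?P\<^esub> R. t \<in> ?IP [^]\<^bsub>ideals_set ?P\<^esub> n +>\<^bsub>?P\<^esub> b"
        by blast
    qed
    then have b_closed: "b \<in> closed_ideal K X S"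
      unfolding assms(10)[symmetric] by (simp add: closed_ideal_def)
    have "b = \<zero>\<^bsub>?A\<^esub>"
    proof (rule ccontr)
      \<comment> \<open>Both rings have the same zero function, so \<open>b\<close> is also a
        nonzero element of the closed ideal, as the basis property of \<open>S\<close>
        requires.\<close>
      assume nz: "b \<noteq> \<zero>\<^bsub>?A\<^esub>"
      then have "mt K preceq b \<in> multiples X (mt K preceq ` S)"
        using b_closed assms(9) by (simp add: GS_basis_series_def)
      moreover have "mt K preceq b \<in> supp K b"
        using nz by (intro preceq.mt_in_supp[OF jb(2)]) (auto simp: supp_def fun_eq_iff)
      ultimately show False using jb(4) assms(11) by auto
    qed
    then show "a \<in> ?J" using jb(1,3) jA by (simp only: A.r_zero)
  qed
qed

end
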